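(* Let $y$ be a real number with $y>e^{e^e}$ and let $x$ be a positive real number satisfying $x^{x^x}=y$. Then: (a) $x<\ln(\ln(y))$; (b) $x>\ln(\ln(\ln(y)))$.
   Context: Here $\ln$ is the natural logarithm and $e$ is its base. Iterated powers are read from the top: $x^{x^x}=x^{(x^x)}$ and $e^{e^e}=e^{(e^e)}$. For $x>0$ and real $t$, $x^t=e^{t\ln x}$. *)

theory Defs
  imports Complex_Main
begin

end

theory Submission
  imports Defs
begin

text \<open>
  Taking logarithms twice turns \<open>x powr (x powr x) = y\<close> into
  \<open>ln (ln y) = x * ln x + ln (ln x)\<close>. The tower \<open>x powr (x powr x)\<close> is increasing for
  \<open>x \<ge> 1\<close> and at most 1 below, so the lower bound on \<open>y\<close> forces \<open>x\<close> to exceed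
  \<open>e = exp 1\<close> (\<open>tower_le_tower_exp_1\<close>). Then \<open>ln x > 1\<close> and \<open>ln (ln x) > 0\<close>, so the right-hand
  side exceeds \<open>x\<close>, which is (a). For (b) it remains to see that the right-hand side
  is below \<open>exp x\<close>: since \<open>ln x \<le> x / e \<le> x / 2\<close>, it is at most quadratic in \<open>x\<close> with
  coefficients dominated by those of the Taylor polynomial of \<open>exp\<close>
  (\<open>mult_ln_add_ln_ln_less_exp\<close>).
\<close>

lemma tower_le_tower_exp_1:
  fixes x :: real
  assumes "0 < x" "x \<le> exp 1"
  shows "x powr (x powr x) \<le> exp 1 powr (exp 1 powr exp 1)"
proof (cases "x \<ge> 1")
  case True
  have "x powr x \<le> exp 1 powr x"
    using assms by (intro powr_mono2) auto
  also have "\<dots> \<le> exp 1 powr exp 1"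
    using assms by (intro powr_mono) auto
  finally have "x powr x \<le> exp 1 powr exp 1" .
  then have "x powr (x powr x) \<le> x powr (exp 1 powr exp 1)"
    using True by (intro powr_mono) auto
  also have "\<dots> \<le> exp 1 powr (exp 1 powr exp 1)"
    using assms by (intro powr_mono2) auto
  finally show ?thesis .
next
  case False
  have "x powr (x powr x) \<le> 1"
    using False assms by (intro powr_le1) auto
  also have "\<dots> \<le> exp 1 powr (exp 1 powr exp 1)"
    by (intro ge_one_powr_ge_zero) auto
  finally show ?thesis .
qed

lemma ln_le_half:
  fixes x :: real
  assumes "0 < x"
  shows "ln x \<le> x / 2"
proof -
  \<comment> \<open>The tangent bound \<open>ln t \<le> t - 1\<close> at \<open>t = x / e\<close> gives \<open>ln x \<le> x / e\<close>, and \<open>e \<ge> 2\<close>.\<close>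
  have "ln (x / exp 1) \<le> x / exp 1 - 1"
    using assms by (intro ln_le_minus_one) auto
  then have "ln x \<le> x / exp 1"
    using assms by (simp add: ln_div)
  also have "\<dots> \<le> x / 2"
    using assms exp_ge_add_one_self[of 1] by (intro divide_left_mono) auto
  finally show ?thesis .
qed

lemma mult_ln_add_ln_ln_less_exp:
  fixes x :: real
  assumes "1 < x"
  shows "x * ln x + ln (ln x) < exp x"
proof -
  have half: "ln x \<le> x / 2"
    using assms by (intro ln_le_half) auto
  have "x * ln x \<le> x * (x / 2)"
    using assms half by (intro mult_left_mono) auto
  moreover have "ln (ln x) \<le> ln x - 1"
    using assms by (intro ln_le_minus_one) auto
  moreover have "1 + x + x\<^sup>2 / 2 \<le> exp x"
    using assms by (intro exp_lower_Taylor_quadratic) auto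
  ultimately show ?thesis
    using half assms unfolding power2_eq_square times_divide_eq_right by linarith
qed

theorem theorem3p2:
  fixes x y :: real
  assumes "y > exp 1 powr (exp 1 powr exp 1)"
    and "x > 0"
    and "x powr (x powr x) = y"
  shows "x < ln (ln y) \<and> x > ln (ln (ln y))"
proof -
  have "x > exp 1"
    using tower_le_tower_exp_1[of x] assms by linarith
  then have ln_gt: "ln x > 1"
    using assms(2) by (metis exp_gt_zero ln_exp ln_less_cancel_iff)
  have x_gt: "x > 1"
    using \<open>x > exp 1\<close> exp_ge_add_one_self[of 1] by linarith
  have "ln y = x powr x * ln x"
    using assms by (auto simp: ln_powr)
  then have lnln: "ln (ln y) = x * ln x + ln (ln x)"
    using ln_gt assms(2) by (simp add: ln_mult ln_powr)
  have "x < x * ln x"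
    using ln_gt x_gt by simp
  then have a: "x < ln (ln y)"
    using lnln ln_gt_zero[OF ln_gt] by linarith
  have "ln (ln y) < exp x"
    using lnln mult_ln_add_ln_ln_less_exp[OF x_gt] by simp
  then have "ln (ln (ln y)) < ln (exp x)"
    using a x_gt by (subst ln_less_cancel_iff) auto
  with a show ?thesis by simp
qed

end
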